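(* Let $P=\{x_1,\ldots,x_d\}$ be a finite partially ordered set. Then the degree sequence of the finite simple graph which is the $1$-skeleton of the order polytope $\mathcal{O}(P)$ is equal to the degree sequence of the $1$-skeleton of the chain polytope $\mathcal{C}(P)$ if and only if $\mathcal{O}(P)$ and $\mathcal{C}(P)$ are unimodularly equivalent.
   Context: The order polytope $\mathcal{O}(P)\subset\mathbb{R}^d$ is the set of $(a_1,\ldots,a_d)\in\mathbb{R}^d$ with $0\le a_i\le 1$ for all $i$ and $a_i\ge a_j$ whenever $x_i\le x_j$ in $P$. The chain polytope $\mathcal{C}(P)\subset\mathbb{R}^d$ is the set of $(a_1,\ldots,a_d)\in\mathbb{R}^d$ with $a_i\ge 0$ for all $i$ and $a_{i_1}+\cdots+a_{i_k}\le 1$ for every maximal chain $x_{i_1}<\cdots<x_{i_k}$ of $P$. Both are $d$-dimensional lattice polytopes. The $1$-skeleton of a polytope is the graph whose vertices are the polytope's vertices and whose edges are pairs of vertices joined by an edge of the polytope. The degree sequence of a finite simple graph is the list of its vertex degrees sorted in nondecreasing order. Two $d$-dimensional integral polytopes $\mathcal{P},\mathcal{Q}\subset\mathbb{R}^d$ are unimodularly equivalent if there exist an integer $d\times d$ matrix $U$ with $\det U=\pm1$ and $\mathbf{w}\in\mathbb{Z}^d$ such that $\mathcal{Q}=\{\mathbf{v}U:\mathbf{v}\in\mathcal{P}\}+\mathbf{w}$. *)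

theory Defs
  imports "HOL-Analysis.Analysis" "HOL-Library.Multiset"
begin

text \<open>
  A poset \<open>{x\<^sub>1, \<dots>, x\<^sub>d}\<close> is a partial order \<open>r\<close> on all of a finite index type \<open>'n\<close>
  with \<open>d\<close> elements: \<open>(i, j) \<in> r\<close> means \<open>x\<^sub>i \<le> x\<^sub>j\<close>.
\<close>

definition order_polytope :: "'n::finite rel \<Rightarrow> (real ^ 'n) set" where
  "order_polytope r =
     {a. (\<forall>i. 0 \<le> a $ i \<and> a $ i \<le> 1) \<and> (\<forall>i j. (i, j) \<in> r \<longrightarrow> a $ i \<ge> a $ j)}"

text \<open>\<^const>\<open>pred_on.maxchain\<close> works with the reflexive closure of its argument, so passing the
  reflexive \<open>r\<close> or its strict part makes no difference.\<close>

definition chain_polytope :: "'n::finite rel \<Rightarrow> (real ^ 'n) set" where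
  "chain_polytope r =
     {a. (\<forall>i. 0 \<le> a $ i) \<and>
         (\<forall>C. pred_on.maxchain UNIV (\<lambda>i j. (i, j) \<in> r) C \<longrightarrow> (\<Sum>i\<in>C. a $ i) \<le> 1)}"

text \<open>Graphs are pairs of a vertex set and a set of edges, each edge a two-element set of vertices.\<close>

definition skeleton1 :: "'a::euclidean_space set \<Rightarrow> 'a set \<times> 'a set set" where
  "skeleton1 S =
     ({v. v extreme_point_of S},
      {{u, v} | u v. u extreme_point_of S \<and> v extreme_point_of S \<and> u \<noteq> v \<and>
                     closed_segment u v edge_of S})"

definition graph_degree :: "'a set \<times> 'a set set \<Rightarrow> 'a \<Rightarrow> nat" where
  "graph_degree G v = card {e \<in> snd G. v \<in> e}"

text \<open>Meaningful only for finite graphs: \<^const>\<open>mset_set\<close> of an infinite set is empty.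
  The skeletons in question are finite by the lemmas at the end.\<close>

definition degree_sequence :: "'a set \<times> 'a set set \<Rightarrow> nat list" where
  "degree_sequence G = sorted_list_of_multiset (image_mset (graph_degree G) (mset_set (fst G)))"

definition unimodularly_equivalent :: "(real ^ 'n::finite) set \<Rightarrow> (real ^ 'n) set \<Rightarrow> bool" where
  "unimodularly_equivalent P Q \<longleftrightarrow>
     (\<exists>(U :: real ^ 'n ^ 'n) (w :: real ^ 'n).
        (\<forall>i j. U $ i $ j \<in> \<int>) \<and> (det U = 1 \<or> det U = - 1) \<and> (\<forall>i. w $ i \<in> \<int>) \<and>
        Q = (\<lambda>v. v v* U + w) ` P)"

lemma polyhedron_coord_ge: "polyhedron {a :: real ^ 'n::finite. 0 \<le> a $ i}"
  using polyhedron_halfspace_ge[where a = "axis i (1::real)" and b = 0] by (simp add: inner_axis' inner_real_def)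

lemma polytope_order_polytope: "polytope (order_polytope (r :: 'n::finite rel))"
proof -
  have le: "polyhedron {a :: real ^ 'n. a $ i \<le> 1}" for i
    using polyhedron_halfspace_le[of "axis i (1::real)" 1] by (simp add: inner_axis' inner_real_def)
  have rel: "polyhedron {a :: real ^ 'n. a $ i \<ge> a $ j}" for i j
    using polyhedron_halfspace_ge[where a = "axis i (1::real) - axis j (1::real)" and b = 0]
    by (simp add: inner_axis' inner_real_def inner_diff_left)
  have "order_polytope r = \<Inter> (range (\<lambda>i. {a. 0 \<le> a $ i}) \<union> range (\<lambda>i. {a. a $ i \<le> 1})
      \<union> (\<lambda>(i, j). {a. a $ i \<ge> a $ j}) ` r)"
    by (auto simp: order_polytope_def)
  also have "polyhedron \<dots>"
    by (rule polyhedron_Inter) (auto simp: polyhedron_coord_ge le rel)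
  finally have "polyhedron (order_polytope r)" .
  moreover have "bounded (order_polytope r)"
    by (rule bounded_subset[OF bounded_cbox[of 0 1]])
      (auto simp: order_polytope_def mem_box_cart)
  ultimately show ?thesis by (simp add: polytope_eq_bounded_polyhedron)
qed

lemma polytope_chain_polytope: "polytope (chain_polytope (r :: 'n::finite rel))"
proof -
  let ?max = "pred_on.maxchain UNIV (\<lambda>i j. (i, j) \<in> r)"
  have sum: "polyhedron {a :: real ^ 'n. (\<Sum>i\<in>C. a $ i) \<le> 1}" for C
    using polyhedron_halfspace_le[of "\<Sum>i\<in>C. axis i (1::real)" 1]
    by (simp add: inner_axis' inner_real_def inner_sum_left)
  have "chain_polytope r = \<Inter> (range (\<lambda>i. {a. 0 \<le> a $ i})
      \<union> (\<lambda>C. {a. (\<Sum>i\<in>C. a $ i) \<le> 1}) ` Collect ?max)"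
    by (auto simp: chain_polytope_def)
  also have "polyhedron \<dots>"
    by (rule polyhedron_Inter) (auto simp: polyhedron_coord_ge sum)
  finally have "polyhedron (chain_polytope r)" .
  moreover have "bounded (chain_polytope r)"
  proof (rule bounded_subset[OF bounded_cbox[of 0 1]], rule subsetI)
    fix a assume a: "a \<in> chain_polytope r"
    have "a $ i \<le> 1" for i
    proof -
      have "finite {C. i \<in> C \<and> pred_on.chain UNIV (\<lambda>i j. (i, j) \<in> r) C}" by simp
      moreover have "{i} \<in> {C. i \<in> C \<and> pred_on.chain UNIV (\<lambda>i j. (i, j) \<in> r) C}"
        by (auto simp: pred_on.chain_def)
      ultimately obtain C where "i \<in> C" and C: "pred_on.chain UNIV (\<lambda>i j. (i, j) \<in> r) C"
        and max: "\<And>D. i \<in> D \<Longrightarrow> pred_on.chain UNIV (\<lambda>i j. (i, j) \<in> r) D \<Longrightarrow> C \<subseteq> D \<Longrightarrow> D = C"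
        by (smt (verit) finite_has_maximal2 mem_Collect_eq)
      have "?max C"
        unfolding pred_on.maxchain_def using C max \<open>i \<in> C\<close> by blast
      then have "(\<Sum>i\<in>C. a $ i) \<le> 1" using a by (simp add: chain_polytope_def)
      moreover have "a $ i \<le> (\<Sum>i\<in>C. a $ i)"
        using a \<open>i \<in> C\<close> by (intro member_le_sum) (auto simp: chain_polytope_def)
      ultimately show ?thesis by simp
    qed
    then show "a \<in> cbox 0 1" using a by (auto simp: chain_polytope_def mem_box_cart)
  qed
  ultimately show ?thesis by (simp add: polytope_eq_bounded_polyhedron)
qed

lemma finite_skeleton1:
  assumes "polytope S"
  shows "finite (fst (skeleton1 S))" "finite (snd (skeleton1 S))"
proof -
  have fin: "finite {v. v extreme_point_of S}"
    using assms finite_polyhedron_extreme_points polytope_imp_polyhedron by blast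
  then show "finite (fst (skeleton1 S))" by (simp add: skeleton1_def)
  have "snd (skeleton1 S) \<subseteq> Pow {v. v extreme_point_of S}"
    by (auto simp: skeleton1_def)
  with fin show "finite (snd (skeleton1 S))" by (meson finite_Pow_iff finite_subset)
qed

end

theory Submission
  imports Defs
begin

text \<open>
  The origin is a vertex of degree \<open>d\<close> of the chain polytope. If some \<open>z\<close> has two incomparable
  elements below it and two incomparable elements above it, then every vertex of the order polytope
  has degree greater than \<open>d\<close>, so the degree sequences differ. If there is no such \<open>z\<close>, then below
  or above each element lies a chain, and taking differences along these chains is a unimodular map
  of the order polytope onto the chain polytope. Unimodular maps preserve degrees.
\<close>

text \<open>The value \<open>d\<close> is a convenient test: on the chain side only the edges at the
  origin have to be classified, and on the order side a lower bound on degrees, hence a sufficient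
  criterion for edges, is enough. The bound has to hold at every vertex, which is why
  \<open>z\<close> comes with two pairs: a down-set that misses \<open>z\<close> gets its extra
  neighbour from the pair above \<open>z\<close>, one that contains \<open>z\<close> from the pair
  below. In the other direction a chain below or above an element makes its lower or upper cover
  unique, so that the difference to the cover is an integer affine function. The inverse sums along
  the chain and is integral too, which settles the determinant without computing it.\<close>

section \<open>Degrees in the 1-skeleton and their invariance under affine bijections\<close>

lemma graph_degree_skeleton1:
  assumes "v extreme_point_of S"
  shows "graph_degree (skeleton1 S) v = card {u. u \<noteq> v \<and> closed_segment v u edge_of S}"
proof -
  let ?N = "{u. u \<noteq> v \<and> closed_segment v u edge_of S}"
  \<comment> \<open>An extreme point of a face is an extreme point of \<open>S\<close>, so the
    vertex condition on the far end of an edge is automatic.\<close>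
  have ext: "u extreme_point_of S" if "closed_segment v u edge_of S" for u
    using that extreme_point_of_face[of "closed_segment v u" S u]
    by (auto simp: edge_of_def extreme_point_of_segment)
  have "{e \<in> snd (skeleton1 S). v \<in> e} = (\<lambda>u. {v, u}) ` ?N" (is "?E = _")
  proof (intro equalityI subsetI)
    fix e assume "e \<in> ?E"
    then obtain a b where "e = {a, b}" "a \<noteq> b" "closed_segment a b edge_of S" "v = a \<or> v = b"
      by (auto simp: skeleton1_def)
    then have "(e = {v, a} \<and> a \<in> ?N) \<or> (e = {v, b} \<and> b \<in> ?N)"
      by (auto simp: closed_segment_commute insert_commute)
    then show "e \<in> (\<lambda>u. {v, u}) ` ?N" by blast
  next
    fix e assume "e \<in> (\<lambda>u. {v, u}) ` ?N"
    then obtain u where "e = {v, u}" "u \<noteq> v" "closed_segment v u edge_of S"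
      by blast
    then show "e \<in> ?E"
      using ext assms unfolding skeleton1_def by auto
  qed
  moreover have "inj_on (\<lambda>u. {v, u}) ?N"
    by (auto simp: inj_on_def doubleton_eq_iff)
  ultimately show ?thesis
    by (simp add: graph_degree_def card_image)
qed

lemma set_degree_sequence_skeleton1:
  assumes "polytope S"
  shows "set (degree_sequence (skeleton1 S)) = graph_degree (skeleton1 S) ` {v. v extreme_point_of S}"
  using finite_skeleton1(1)[OF assms] by (simp add: degree_sequence_def skeleton1_def)

lemma degree_sequence_affine_image:
  fixes f :: "'a::euclidean_space \<Rightarrow> 'a"
  assumes "linear f" "inj f"
  shows "degree_sequence (skeleton1 ((\<lambda>x. f x + w) ` S)) = degree_sequence (skeleton1 S)"
proof -
  define g where "g = (\<lambda>x. f x + w)"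
  have img: "g ` T = (+) w ` f ` T" for T
    by (auto simp: g_def add.commute image_image)
  have inj: "inj g"
    using assms(2) by (simp add: g_def inj_def)
  have surj: "surj g"
  proof
    show "UNIV \<subseteq> range g"
    proof
      fix y
      obtain x where "y - w = f x"
        using linear_injective_imp_surjective[OF assms] by (metis surjD)
      then show "y \<in> range g" by (auto simp: g_def intro!: image_eqI[of _ _ x] dest: sym)
    qed
  qed simp
  have seg: "closed_segment (g a) (g b) = g ` closed_segment a b" for a b
    unfolding img closed_segment_linear_image[OF assms(1), symmetric] closed_segment_translation[symmetric]
    by (simp add: g_def add.commute)
  have edge: "g ` T edge_of g ` S \<longleftrightarrow> T edge_of S" for T
    by (simp add: edge_of_def img aff_dim_translation_eq face_of_linear_image assms)
  have ext: "g v extreme_point_of g ` S \<longleftrightarrow> v extreme_point_of S" for v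
    using face_of_linear_image[OF assms, of "{v}" S]
      extreme_point_of_translation_eq[of w "f v" "f ` S"]
    by (simp add: img face_of_singleton) (simp add: g_def add.commute)
  have verts: "{v. v extreme_point_of g ` S} = g ` {v. v extreme_point_of S}"
    using ext surj by (auto simp: image_iff) (metis surjD)
  have deg: "graph_degree (skeleton1 (g ` S)) (g v) = graph_degree (skeleton1 S) v"
    if v: "v extreme_point_of S" for v
  proof -
    have "{u. u \<noteq> g v \<and> closed_segment (g v) u edge_of g ` S}
        = g ` {u. u \<noteq> v \<and> closed_segment v u edge_of S}"
      using surj inj by (auto simp: image_iff seg edge inj_eq) (metis surjD seg edge)
    then show ?thesis
      using v ext inj by (simp add: graph_degree_skeleton1 card_image inj_on_subset)
  qed
  have "image_mset (graph_degree (skeleton1 (g ` S))) (mset_set {v. v extreme_point_of g ` S})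
      = image_mset (\<lambda>v. graph_degree (skeleton1 (g ` S)) (g v)) (mset_set {v. v extreme_point_of S})"
    unfolding verts using inj image_mset_mset_set[of g "{v. v extreme_point_of S}"]
    by (simp add: inj_on_subset multiset.map_comp comp_def flip: image_mset_mset_set)
  \<comment> \<open>If there are infinitely many vertices, \<open>mset_set\<close> is empty and both
    sides agree trivially.\<close>
  also have "\<dots> = image_mset (graph_degree (skeleton1 S)) (mset_set {v. v extreme_point_of S})"
    by (rule image_mset_cong) (metis deg elem_mset_set infinite_set_mset_mset_set empty_iff mem_Collect_eq)
  finally show ?thesis
    by (simp add: degree_sequence_def skeleton1_def g_def)
qed

lemma unimodularly_equivalent_imp_degree_sequence_eq:
  fixes P Q :: "(real ^ 'n::finite) set"
  assumes "unimodularly_equivalent P Q"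
  shows "degree_sequence (skeleton1 P) = degree_sequence (skeleton1 Q)"
proof -
  obtain U :: "real ^ 'n ^ 'n" and w where U: "det U = 1 \<or> det U = - 1" and Q: "Q = (\<lambda>v. v v* U + w) ` P"
    using assms by (auto simp: unimodularly_equivalent_def)
  have eq: "(\<lambda>v. v v* U) = (*v) (transpose U)" by (simp add: fun_eq_iff)
  have "invertible (transpose U)" using U by (auto simp: invertible_det_nz)
  then have "linear (\<lambda>v. v v* U)" "inj (\<lambda>v. v v* U)"
    using matrix_vector_mul_linear[of "transpose U"] inj_matrix_vector_mult[of "transpose U"]
    by (metis eq)+
  then show ?thesis
    unfolding Q by (rule degree_sequence_affine_image[symmetric])
qed

section \<open>The chain polytope and its vertex at the origin\<close>

text \<open>Every chain extends to a maximal one, and nonnegative coordinates only increase the sum.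
  This allows testing on singletons and on chains that are not maximal.\<close>

lemma chain_polytope_alt:
  "chain_polytope r = {a. (\<forall>i. 0 \<le> a $ i) \<and> (\<forall>C. total_on C r \<longrightarrow> (\<Sum>i\<in>C. a $ i) \<le> 1)}"
proof -
  let ?ch = "pred_on.chain UNIV (\<lambda>i j. (i, j) \<in> r)"
  let ?max = "pred_on.maxchain UNIV (\<lambda>i j. (i, j) \<in> r)"
  have ch: "?ch C \<longleftrightarrow> total_on C r" for C
    by (auto simp: pred_on.chain_def total_on_def)
  have "(\<Sum>i\<in>C. a $ i) \<le> 1"
    if nn: "\<forall>i. 0 \<le> a $ i" and le: "\<forall>C. ?max C \<longrightarrow> (\<Sum>i\<in>C. a $ i) \<le> 1" and C: "total_on C r"
    for a :: "real ^ 'a" and C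
  proof -
    have "finite {D. ?ch D}" by simp
    then obtain D where D: "?ch D" "C \<subseteq> D" "\<And>E. ?ch E \<Longrightarrow> D \<subseteq> E \<Longrightarrow> E = D"
      by (smt (verit) C ch finite_has_maximal2 mem_Collect_eq)
    then have "?max D" unfolding pred_on.maxchain_def by blast
    then have "(\<Sum>i\<in>D. a $ i) \<le> 1" using le by blast
    moreover have "(\<Sum>i\<in>C. a $ i) \<le> (\<Sum>i\<in>D. a $ i)"
      using nn D(2) by (intro sum_mono2) auto
    ultimately show ?thesis by linarith
  qed
  moreover have "?max C \<Longrightarrow> total_on C r" for C
    by (simp add: pred_on.maxchain_def ch)
  ultimately show ?thesis
    unfolding chain_polytope_def by blast
qed

lemma edge_of_segmentI:
  assumes "u \<noteq> v" "closed_segment u v face_of S"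
  shows "closed_segment u v edge_of S"
  using assms by (simp add: edge_of_def segment_convex_hull aff_dim_convex_hull)

text \<open>The tool for recognising faces: a valid inequality that is tight at an inner point of a
  segment is tight at both ends.\<close>

lemma convex_combination_eqD:
  fixes a b :: real
  assumes "0 < t" "t < 1" "a \<le> a'" "b \<le> b'" "(1 - t) * a + t * b = (1 - t) * a' + t * b'"
  shows "a = a'" "b = b'"
proof -
  have "0 \<le> (1 - t) * (a' - a)" "0 \<le> t * (b' - b)"
    using assms by auto
  moreover have "(1 - t) * (a' - a) + t * (b' - b) = 0"
    using assms(5) by (simp add: algebra_simps)
  ultimately have "(1 - t) * (a' - a) = 0" "t * (b' - b) = 0" by linarith+
  then show "a = a'" "b = b'" using assms by auto
qed

lemma zero_extreme_point_chain_polytope: "0 extreme_point_of chain_polytope r"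
proof -
  have "0 \<notin> open_segment a b" if "a \<in> chain_polytope r" "b \<in> chain_polytope r" for a b
  proof
    assume "0 \<in> open_segment a b"
    then obtain t where t: "a \<noteq> b" "0 < t" "t < 1" "0 = (1 - t) *\<^sub>R a + t *\<^sub>R b"
      by (auto simp: in_segment)
    have "a $ i = 0 \<and> b $ i = 0" for i
    proof -
      have "0 \<le> a $ i" "0 \<le> b $ i" using that by (auto simp: chain_polytope_def)
      moreover have "(1 - t) * a $ i + t * b $ i = 0"
        using arg_cong[OF t(4), of "\<lambda>x. x $ i"] by simp
      ultimately show ?thesis
        using convex_combination_eqD[OF t(2,3), of 0 "a $ i" 0 "b $ i"] by simp
    qed
    then show False using t(1) by (simp add: vec_eq_iff)
  qed
  then show ?thesis
    by (auto simp: extreme_point_of_def chain_polytope_def)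
qed

lemma axis_mem_chain_polytope: "axis i 1 \<in> chain_polytope r"
  by (auto simp: chain_polytope_alt axis_def sum.delta if_distrib)

text \<open>The segment is the face on which the inequalities \<open>0 \<le> a $ j\<close> for
  \<open>j \<noteq> i\<close> are tight; the chain \<open>{i}\<close> bounds the remaining
  coordinate by 1.\<close>

lemma edge_of_chain_polytope_axis: "closed_segment 0 (axis i 1) edge_of chain_polytope r"
proof (rule edge_of_segmentI)
  show "0 \<noteq> axis i (1::real)" by (metis axis_eq_0_iff zero_neq_one)
  have "{c. \<forall>j. j \<noteq> i \<longrightarrow> c $ j = 0} \<inter> chain_polytope r = closed_segment 0 (axis i 1)" (is "?F = _")
  proof (intro equalityI subsetI)
    fix c assume c: "c \<in> ?F"
    have "(\<Sum>j\<in>{i}. c $ j) \<le> 1"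
      using c by (subst (asm) chain_polytope_alt) (auto simp: total_on_def)
    then have "0 \<le> c $ i" "c $ i \<le> 1" using c by (auto simp: chain_polytope_def)
    moreover have "c = (c $ i) *\<^sub>R axis i 1"
      using c by (auto simp: vec_eq_iff axis_def)
    ultimately show "c \<in> closed_segment 0 (axis i 1)"
      by (auto simp: in_segment)
  next
    fix c :: "real ^ 'a" assume "c \<in> closed_segment 0 (axis i 1)"
    then obtain t where t: "0 \<le> t" "t \<le> 1" "c = t *\<^sub>R axis i 1"
      by (auto simp: in_segment)
    have "c $ j = (if j = i then t else 0)" for j by (simp add: t(3) axis_def)
    then show "c \<in> ?F"
      using t by (auto simp: chain_polytope_alt sum.delta)
  qed
  moreover have "?F face_of chain_polytope r"
    unfolding face_of_def
  proof (intro conjI ballI impI)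
    show "convex ?F"
      by (metis calculation convex_closed_segment)
    fix a b x assume *: "a \<in> chain_polytope r" "b \<in> chain_polytope r" "x \<in> ?F" "x \<in> open_segment a b"
    then obtain t where t: "0 < t" "t < 1" "x = (1 - t) *\<^sub>R a + t *\<^sub>R b"
      by (auto simp: in_segment)
    have "a $ j = 0 \<and> b $ j = 0" if "j \<noteq> i" for j
    proof -
      have "0 \<le> a $ j" "0 \<le> b $ j" using * by (auto simp: chain_polytope_def)
      moreover have "(1 - t) * a $ j + t * b $ j = 0"
        using arg_cong[OF t(3), of "\<lambda>x. x $ j"] *(3) that by simp
      ultimately show ?thesis
        using convex_combination_eqD[OF t(1,2), of 0 "a $ j" 0 "b $ j"] by simp
    qed
    then show "a \<in> ?F" "b \<in> ?F" using * by auto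
  qed simp
  ultimately show "closed_segment 0 (axis i 1) face_of chain_polytope r" by simp
qed

text \<open>If \<open>v\<close> had two nonzero coordinates, \<open>v / 2\<close> would be the midpoint of the projections of \<open>v\<close>
  to one coordinate and to the others, and these lie off the segment from \<open>0\<close> to \<open>v\<close>.\<close>

lemma edge_of_chain_polytope_zeroD:
  assumes edge: "closed_segment 0 v edge_of chain_polytope r" and "v \<noteq> 0"
  shows "v \<in> range (\<lambda>i. axis i 1)"
proof -
  let ?C = "chain_polytope r"
  have face: "closed_segment 0 v face_of ?C" using edge by (simp add: edge_of_def)
  then have vC: "v \<in> ?C" by (auto simp: face_of_def)
  have vext: "v extreme_point_of ?C"
    using extreme_point_of_face[OF face, of v] by (simp add: extreme_point_of_segment)
  obtain i where i: "v $ i \<noteq> 0" using \<open>v \<noteq> 0\<close> by (auto simp: vec_eq_iff)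
  define p where "p = (\<chi> j. if j = i then v $ i else 0)"
  \<comment> \<open>Lowering coordinates, but not below 0, stays inside the polytope; hence both
    projections of \<open>v\<close> belong to it.\<close>
  have down: "a \<in> ?C" if "\<And>j. 0 \<le> a $ j" "\<And>j. a $ j \<le> v $ j" for a
  proof -
    have "(\<Sum>j\<in>C. a $ j) \<le> 1" if "total_on C r" for C
      using sum_mono[of C "($) a" "($) v"] \<open>\<And>j. a $ j \<le> v $ j\<close> vC that
      unfolding chain_polytope_alt by force
    then show ?thesis using that by (simp add: chain_polytope_alt)
  qed
  have nn: "0 \<le> v $ j" for j using vC by (simp add: chain_polytope_def)
  have pC: "p \<in> ?C" "v - p \<in> ?C" by (rule down; simp add: p_def nn)+
  have pseg: "p \<in> closed_segment 0 v"
  proof (cases "p = v - p")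
    case True
    then have "v = 2 *\<^sub>R p" by (simp add: scaleR_2 algebra_simps)
    then have "p = (1/2) *\<^sub>R v" by simp
    then show ?thesis unfolding in_segment by (intro exI[of _ "1/2"]) simp
  next
    case False
    have "(1/2) *\<^sub>R v = (1 - 1/2) *\<^sub>R p + (1/2) *\<^sub>R (v - p)"
      by (simp add: algebra_simps)
    then have "(1/2) *\<^sub>R v \<in> open_segment p (v - p)"
      unfolding in_segment using False by (intro conjI exI[of _ "1/2"]) auto
    moreover have "(1/2) *\<^sub>R v \<in> closed_segment 0 v"
      unfolding in_segment by (intro exI[of _ "1/2"]) simp
    ultimately show ?thesis using face pC unfolding face_of_def by blast
  qed
  then obtain t where t: "p = t *\<^sub>R v" by (auto simp: in_segment)
  have "p $ i = t * v $ i" by (simp add: t)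
  then have "v $ i = t * v $ i" by (simp add: p_def)
  then have "p = v" using i t by simp
  have "p $ j = 0" if "j \<noteq> i" for j using that by (simp add: p_def)
  then have v: "v $ j = 0" if "j \<noteq> i" for j unfolding \<open>p = v\<close> using that .
  have "v $ i \<le> 1"
    using vC[unfolded chain_polytope_alt] by (auto dest!: spec[of _ "{i}"] simp: total_on_def)
  \<comment> \<open>A single nonzero coordinate below 1 would place the vertex \<open>v\<close>
    strictly between 0 and \<open>axis i 1\<close>.\<close>
  have "v $ i = 1"
  proof (rule ccontr)
    assume "v $ i \<noteq> 1"
    then have "v $ i < 1" "0 < v $ i" using \<open>v $ i \<le> 1\<close> nn[of i] i by auto
    moreover have "v = (1 - v $ i) *\<^sub>R 0 + (v $ i) *\<^sub>R axis i 1"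
      using v by (auto simp: vec_eq_iff axis_def)
    moreover have "0 \<noteq> axis i (1::real)" by (metis axis_eq_0_iff zero_neq_one)
    ultimately have "v \<in> open_segment 0 (axis i 1)" unfolding in_segment by blast
    then show False
      using vext axis_mem_chain_polytope zero_extreme_point_chain_polytope
      unfolding extreme_point_of_def by blast
  qed
  then have "v = axis i 1" using v by (auto simp: vec_eq_iff axis_def)
  then show ?thesis by blast
qed

lemma graph_degree_chain_polytope_zero:
  fixes r :: "'n::finite rel"
  shows "graph_degree (skeleton1 (chain_polytope r)) 0 = CARD('n)"
proof -
  have "{u. u \<noteq> 0 \<and> closed_segment 0 u edge_of chain_polytope r} = range (\<lambda>i. axis i 1)"
    using edge_of_chain_polytope_zeroD edge_of_chain_polytope_axis
    by (fastforce simp: axis_eq_0_iff)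
  moreover have "inj (\<lambda>i::'n. axis i (1::real))"
    by (auto simp: inj_def axis_eq_axis)
  ultimately show ?thesis
    by (simp add: graph_degree_skeleton1 zero_extreme_point_chain_polytope card_image)
qed

section \<open>Vertices and edges of the order polytope\<close>

definition indicator_vec :: "'n::finite set \<Rightarrow> real ^ 'n" where
  "indicator_vec I = (\<chi> i. of_bool (i \<in> I))"

lemma indicator_vec_eq_iff [simp]: "indicator_vec I = indicator_vec J \<longleftrightarrow> I = J"
  by (auto simp: indicator_vec_def vec_eq_iff of_bool_def split: if_splits)

lemma extreme_point_of_order_polytope:
  assumes "v extreme_point_of order_polytope r"
  obtains I where "v = indicator_vec I" "\<And>i j. (i, j) \<in> r \<Longrightarrow> j \<in> I \<Longrightarrow> i \<in> I"
proof -
  have v: "v \<in> order_polytope r" using assms by (simp add: extreme_point_of_def)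
  \<comment> \<open>Both \<open>x\<^sup>2\<close> and \<open>2 x - x\<^sup>2\<close> are increasing maps of \<open>[0, 1]\<close> to itself, and \<open>x\<close> is their mean.\<close>
  define a b where "a = (\<chi> i. (v $ i)\<^sup>2)" and "b = (\<chi> i. 2 * v $ i - (v $ i)\<^sup>2)"
  have b: "b $ i = 1 - (1 - v $ i)\<^sup>2" for i by (simp add: b_def power2_eq_square algebra_simps)
  have "a \<in> order_polytope r"
    using v by (auto simp: order_polytope_def a_def power_le_one power_mono)
  moreover have "b \<in> order_polytope r"
    using v by (auto simp: order_polytope_def b power_le_one power_mono)
  moreover have "v \<in> open_segment a b" if "a \<noteq> b"
  proof -
    have "v = (1 - 1/2) *\<^sub>R a + (1/2) *\<^sub>R b"
      by (simp add: vec_eq_iff a_def b_def field_simps)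
    then show ?thesis
      unfolding in_segment using that by (intro conjI exI[of _ "1/2"]) auto
  qed
  ultimately have "a = b"
    using assms unfolding extreme_point_of_def by blast
  then have "v $ i = 0 \<or> v $ i = 1" for i
    by (auto simp: a_def b_def vec_eq_iff power2_eq_square algebra_simps)
  then have "v $ i = of_bool (v $ i = 1)" for i by (metis of_bool_eq)
  then have "v = indicator_vec {i. v $ i = 1}"
    unfolding indicator_vec_def vec_eq_iff vec_lambda_beta mem_Collect_eq by blast
  moreover have "v $ i = 1" if "(i, j) \<in> r" "v $ j = 1" for i j
    using v that by (force simp: order_polytope_def intro: antisym)
  ultimately show thesis using that by blast
qed

text \<open>The last hypothesis expresses connectedness of \<open>J - I\<close>: a function that is constant along
  comparabilities is constant.\<close>

lemma edge_of_order_polytope: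
  fixes r :: "'n::finite rel"
  assumes I: "\<And>i j. (i, j) \<in> r \<Longrightarrow> j \<in> I \<Longrightarrow> i \<in> I"
    and J: "\<And>i j. (i, j) \<in> r \<Longrightarrow> j \<in> J \<Longrightarrow> i \<in> J"
    and IJ: "I \<subset> J"
    and conn: "\<And>f :: 'n \<Rightarrow> real. (\<And>i j. i \<in> J - I \<Longrightarrow> j \<in> J - I \<Longrightarrow> (i, j) \<in> r \<Longrightarrow> f i = f j)
      \<Longrightarrow> \<exists>c. \<forall>i\<in>J - I. f i = c"
  shows "closed_segment (indicator_vec I) (indicator_vec J) edge_of order_polytope r"
proof (rule edge_of_segmentI)
  let ?O = "order_polytope r"
  show "indicator_vec I \<noteq> indicator_vec J" using IJ by auto
  \<comment> \<open>Each condition makes a valid inequality tight, so \<open>?F\<close> is a face;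
    by \<open>conn\<close> only one common value on \<open>J - I\<close> stays free, so it is a
    segment.\<close>
  let ?F = "{c \<in> ?O. (\<forall>i\<in>I. c $ i = 1) \<and> (\<forall>i. i \<notin> J \<longrightarrow> c $ i = 0) \<and>
    (\<forall>i\<in>J - I. \<forall>j\<in>J - I. (i, j) \<in> r \<longrightarrow> c $ i = c $ j)}"
  have F: "?F = closed_segment (indicator_vec I) (indicator_vec J)"
  proof (intro equalityI subsetI)
    fix c assume c: "c \<in> ?F"
    then obtain t where t: "\<And>i. i \<in> J - I \<Longrightarrow> c $ i = t" using conn[of "($) c"] by blast
    obtain k where "k \<in> J - I" using IJ by blast
    then have "0 \<le> t" "t \<le> 1" using t c by (auto simp: order_polytope_def)
    moreover have "c = (1 - t) *\<^sub>R indicator_vec I + t *\<^sub>R indicator_vec J"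
      unfolding vec_eq_iff
    proof
      fix i
      show "c $ i = ((1 - t) *\<^sub>R indicator_vec I + t *\<^sub>R indicator_vec J) $ i"
        using c t IJ by (cases "i \<in> I"; cases "i \<in> J") (auto simp: indicator_vec_def)
    qed
    ultimately show "c \<in> closed_segment (indicator_vec I) (indicator_vec J)"
      unfolding in_segment by blast
  next
    fix c :: "real ^ 'n" assume "c \<in> closed_segment (indicator_vec I) (indicator_vec J)"
    then obtain t where t: "0 \<le> t" "t \<le> 1" "c = (1 - t) *\<^sub>R indicator_vec I + t *\<^sub>R indicator_vec J"
      by (auto simp: in_segment)
    have c: "c $ i = (if i \<in> I then 1 else if i \<in> J then t else 0)" for i
      using IJ by (auto simp: t(3) indicator_vec_def)
    have "c \<in> ?O"
      using t(1,2) I J by (auto simp: order_polytope_def c)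
    then show "c \<in> ?F" using IJ by (auto simp: c)
  qed
  have "?F face_of ?O"
    unfolding face_of_def
  proof (intro conjI ballI impI)
    show "convex ?F" unfolding F by (rule convex_closed_segment)
    fix a b x assume *: "a \<in> ?O" "b \<in> ?O" "x \<in> ?F" "x \<in> open_segment a b"
    then obtain t where t: "0 < t" "t < 1" and x: "x = (1 - t) *\<^sub>R a + t *\<^sub>R b"
      by (auto simp: in_segment)
    have x: "x $ i = (1 - t) * a $ i + t * b $ i" for i by (simp add: x)
    note extremal = convex_combination_eqD[OF t]
    have "a $ i = 1" "b $ i = 1" if "i \<in> I" for i
      using extremal[of "a $ i" 1 "b $ i" 1] *(1-3) x[of i] that by (auto simp: order_polytope_def)
    moreover have "a $ i = 0" "b $ i = 0" if "i \<notin> J" for i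
      using extremal[of 0 "a $ i" 0 "b $ i"] *(1-3) x[of i] that by (auto simp: order_polytope_def)
    moreover have "a $ i = a $ j" "b $ i = b $ j" if "i \<in> J - I" "j \<in> J - I" "(i, j) \<in> r" for i j
    proof -
      have le: "a $ j \<le> a $ i" "b $ j \<le> b $ i" and "x $ i = x $ j"
        using *(1-3) that by (auto simp: order_polytope_def)
      then have eq: "(1 - t) * a $ j + t * b $ j = (1 - t) * a $ i + t * b $ i"
        unfolding x by linarith
      show "a $ i = a $ j" "b $ i = b $ j"
        using extremal[OF le eq] by simp_all
    qed
    ultimately show "a \<in> ?F" "b \<in> ?F" using *(1,2) by auto
  qed blast
  then show "closed_segment (indicator_vec I) (indicator_vec J) face_of ?O"
    unfolding F .
qed

text \<open>The vertex of a down-set \<open>I\<close> has the neighbours \<open>I \<union> \<down>x\<close> for \<open>x \<notin> I\<close> and \<open>I - \<up>x\<close> for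
  \<open>x \<in> I\<close>. If \<open>z \<notin> I\<close> lies below incomparable \<open>x\<close> and \<open>y\<close>, then \<open>I \<union> \<down>x \<union> \<down>y\<close> is one more
  neighbour; the case \<open>z \<in> I\<close> is dual.\<close>

lemma graph_degree_order_polytope_gt:
  fixes r :: "'n::finite rel"
  assumes po: "partial_order_on UNIV r"
    and below: "\<not> total_on (under r z) r" and above: "\<not> total_on (above r z) r"
    and v: "v extreme_point_of order_polytope r"
  shows "CARD('n) < graph_degree (skeleton1 (order_polytope r)) v"
proof -
  have refl: "(i, i) \<in> r" for i
    using po by (auto simp: partial_order_on_def preorder_on_def refl_on_def)
  have trans: "(i, k) \<in> r" if "(i, j) \<in> r" "(j, k) \<in> r" for i j k
    using po that by (auto simp: partial_order_on_def preorder_on_def dest: transD)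
  have antisym: "i = j" if "(i, j) \<in> r" "(j, i) \<in> r" for i j
    using po that by (auto simp: partial_order_on_def dest: antisymD)
  obtain I where vI: "v = indicator_vec I" and I: "\<And>i j. (i, j) \<in> r \<Longrightarrow> j \<in> I \<Longrightarrow> i \<in> I"
    using extreme_point_of_order_polytope[OF v] by metis
  define N where "N = {J. J \<noteq> I \<and> closed_segment (indicator_vec I) (indicator_vec J) edge_of order_polytope r}"
  define F where "F x = (if x \<in> I then I - above r x else I \<union> under r x)" for x
  have F_iff: "k \<in> F x \<longleftrightarrow> (if x \<in> I then k \<in> I \<and> (x, k) \<notin> r else k \<in> I \<or> (k, x) \<in> r)" for k x
    by (simp add: F_def under_def above_def)
  have "F x \<in> N" for x
  proof (cases "x \<in> I")
    case True
    have "closed_segment (indicator_vec (I - above r x)) (indicator_vec I) edge_of order_polytope r"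
    proof (rule edge_of_order_polytope)
      fix f :: "'n \<Rightarrow> real"
      assume f: "\<And>i j. i \<in> I - (I - above r x) \<Longrightarrow> j \<in> I - (I - above r x) \<Longrightarrow> (i, j) \<in> r \<Longrightarrow> f i = f j"
      have "f i = f x" if "i \<in> I - (I - above r x)" for i
        using f[of x i] that True refl[of x] by (auto simp: above_def)
      then show "\<exists>c. \<forall>i\<in>I - (I - above r x). f i = c" by blast
    qed (unfold above_def, (use I trans refl True in blast)+)
    then show ?thesis
      using True refl by (auto simp: N_def F_def closed_segment_commute above_def)
  next
    case False
    have "closed_segment (indicator_vec I) (indicator_vec (I \<union> under r x)) edge_of order_polytope r"
    proof (rule edge_of_order_polytope)
      fix f :: "'n \<Rightarrow> real"
      assume f: "\<And>i j. i \<in> I \<union> under r x - I \<Longrightarrow> j \<in> I \<union> under r x - I \<Longrightarrow> (i, j) \<in> r \<Longrightarrow> f i = f j"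
      have "f i = f x" if "i \<in> I \<union> under r x - I" for i
        using f[of i x] that False refl[of x] by (auto simp: under_def)
      then show "\<exists>c. \<forall>i\<in>I \<union> under r x - I. f i = c" by blast
    qed (unfold under_def, (use I trans refl False in blast)+)
    then show ?thesis
      using False refl by (auto simp: N_def F_def under_def)
  qed
  moreover have "inj F"
  proof
    fix x y assume eq: "F x = F y"
    \<comment> \<open>Passing from \<open>I\<close> to \<open>F x\<close> flips the membership of
      \<open>x\<close>. If \<open>F x = F y\<close>, each of \<open>x\<close> and \<open>y\<close>
      is flipped by the other as well, which forces comparability in both directions.\<close>
    have "x \<in> F x \<longleftrightarrow> x \<in> F y" "y \<in> F x \<longleftrightarrow> y \<in> F y" using eq by simp_all
    then have "(x, y) \<in> r" "(y, x) \<in> r"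
      using refl[of x] refl[of y] by (auto simp: F_iff split: if_splits)
    then show "x = y" by (rule antisym)
  qed
  moreover have "\<exists>J \<in> N. J \<notin> range F"
  proof (cases "z \<in> I")
    case True
    obtain x y where xy: "(x, z) \<in> r" "(y, z) \<in> r" "(x, y) \<notin> r" "(y, x) \<notin> r"
      using below by (auto simp: total_on_def under_def)
    let ?J = "I - (above r x \<union> above r y)"
    have mem: "x \<in> I" "y \<in> I" using xy I True by auto
    have "closed_segment (indicator_vec ?J) (indicator_vec I) edge_of order_polytope r"
    proof (rule edge_of_order_polytope)
      fix f :: "'n \<Rightarrow> real"
      assume f: "\<And>i j. i \<in> I - ?J \<Longrightarrow> j \<in> I - ?J \<Longrightarrow> (i, j) \<in> r \<Longrightarrow> f i = f j"
      \<comment> \<open>The removed set contains \<open>z\<close>, which lies above both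
        \<open>x\<close> and \<open>y\<close> and so joins their two branches.\<close>
      have "f x = f z" "f y = f z"
        using f[of x z] f[of y z] mem xy True refl by (auto simp: above_def)
      moreover have "f i = f x \<or> f i = f y" if "i \<in> I - ?J" for i
        using that mem refl f[of x i] f[of y i] by (auto simp: above_def)
      ultimately show "\<exists>c. \<forall>i\<in>I - ?J. f i = c" by metis
    qed (unfold above_def, (use I trans refl mem in blast)+)
    then have "?J \<in> N"
      using mem refl[of x] by (auto simp: N_def closed_segment_commute above_def)
    moreover have "?J \<noteq> F w" for w
    proof
      assume eq: "?J = F w"
      have iff: "k \<in> F w \<longleftrightarrow> k \<in> I \<and> (x, k) \<notin> r \<and> (y, k) \<notin> r" for k
        unfolding eq[symmetric] by (simp add: above_def)
      \<comment> \<open>As \<open>F w\<close> flips \<open>w\<close> and \<open>?J\<close> only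
        removes elements, \<open>w\<close> is removed. It then lies above one of \<open>x\<close>,
        \<open>y\<close> and, since \<open>F w\<close> removes these, below both, making them
        comparable.\<close>
      have "w \<in> I" using iff[of w] refl[of w] by (simp add: F_iff split: if_splits)
      then have "(w, x) \<in> r" "(w, y) \<in> r" "(x, w) \<in> r \<or> (y, w) \<in> r"
        using iff[of x] iff[of y] iff[of w] refl mem by (auto simp: F_iff)
      then show False using trans xy by blast
    qed
    ultimately show ?thesis by blast
  next
    case False
    obtain x y where xy: "(z, x) \<in> r" "(z, y) \<in> r" "(x, y) \<notin> r" "(y, x) \<notin> r"
      using above by (auto simp: total_on_def above_def)
    let ?J = "I \<union> (under r x \<union> under r y)"
    have mem: "x \<notin> I" "y \<notin> I" using xy I False by auto
    have "closed_segment (indicator_vec I) (indicator_vec ?J) edge_of order_polytope r"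
    proof (rule edge_of_order_polytope)
      fix f :: "'n \<Rightarrow> real"
      assume f: "\<And>i j. i \<in> ?J - I \<Longrightarrow> j \<in> ?J - I \<Longrightarrow> (i, j) \<in> r \<Longrightarrow> f i = f j"
      have "f z = f x" "f z = f y"
        using f[of z x] f[of z y] mem xy False refl by (auto simp: under_def)
      moreover have "f i = f x \<or> f i = f y" if "i \<in> ?J - I" for i
        using that mem refl f[of i x] f[of i y] by (auto simp: under_def)
      ultimately show "\<exists>c. \<forall>i\<in>?J - I. f i = c" by metis
    qed (unfold under_def, (use I trans refl mem in blast)+)
    then have "?J \<in> N"
      using mem refl[of x] by (auto simp: N_def under_def)
    moreover have "?J \<noteq> F w" for w
    proof
      assume eq: "?J = F w"
      have iff: "k \<in> F w \<longleftrightarrow> k \<in> I \<or> (k, x) \<in> r \<or> (k, y) \<in> r" for k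
        unfolding eq[symmetric] by (auto simp: under_def)
      have "w \<notin> I" using iff[of w] refl[of w] by (simp add: F_iff split: if_splits)
      then have "(x, w) \<in> r" "(y, w) \<in> r" "(w, x) \<in> r \<or> (w, y) \<in> r"
        using iff[of x] iff[of y] iff[of w] refl mem by (auto simp: F_iff)
      then show False using trans xy by blast
    qed
    ultimately show ?thesis by blast
  qed
  ultimately have "range F \<subset> N" "card (range F) = CARD('n)"
    by (auto simp: card_image)
  then have "CARD('n) < card N"
    by (metis finite psubset_card_mono)
  also have "card N = card (indicator_vec ` N)"
    by (simp add: card_image inj_on_def)
  also have "\<dots> \<le> card {u. u \<noteq> v \<and> closed_segment v u edge_of order_polytope r}"
  proof (rule card_mono)
    have "{u. u \<noteq> v \<and> closed_segment v u edge_of order_polytope r} \<subseteq> {u. u extreme_point_of order_polytope r}"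
      using extreme_point_of_face by (fastforce simp: edge_of_def extreme_point_of_segment)
    then show "finite {u. u \<noteq> v \<and> closed_segment v u edge_of order_polytope r}"
      using finite_skeleton1(1)[OF polytope_order_polytope, of r]
      unfolding skeleton1_def fst_conv by (rule finite_subset)
  qed (auto simp: N_def vI)
  finally show ?thesis using v by (simp add: graph_degree_skeleton1)
qed

lemma degree_sequence_eq_imp_total_on:
  fixes r :: "'n::finite rel"
  assumes "partial_order_on UNIV r"
    and "degree_sequence (skeleton1 (order_polytope r)) = degree_sequence (skeleton1 (chain_polytope r))"
  shows "total_on (under r z) r \<or> total_on (above r z) r"
proof (rule ccontr)
  assume "\<not> ?thesis"
  then have "CARD('n) \<notin> set (degree_sequence (skeleton1 (order_polytope r)))"
    using graph_degree_order_polytope_gt[OF assms(1)]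
    by (force simp: set_degree_sequence_skeleton1 polytope_order_polytope)
  moreover have "CARD('n) \<in> set (degree_sequence (skeleton1 (chain_polytope r)))"
    using zero_extreme_point_chain_polytope[of r] graph_degree_chain_polytope_zero[of r]
    by (force simp: set_degree_sequence_skeleton1 polytope_chain_polytope)
  ultimately show False using assms(2) by simp
qed

section \<open>Unique covers and the unimodular map\<close>

lemma finite_total_on_greatest:
  assumes "finite S" "S \<noteq> {}" "total_on S r" "refl r" "trans r"
  shows "\<exists>m\<in>S. \<forall>k\<in>S. (k, m) \<in> r"
  using assms(1-3)
proof (induction rule: finite_ne_induct)
  case (singleton x)
  then show ?case using \<open>refl r\<close> by (simp add: refl_onD)
next
  case (insert x F)
  then obtain m where m: "m \<in> F" "\<forall>k\<in>F. (k, m) \<in> r" by (auto simp: total_on_def)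
  then have "(x, m) \<in> r \<or> (m, x) \<in> r"
    using insert.prems insert.hyps by (auto simp: total_on_def)
  then show ?case
  proof
    assume "(m, x) \<in> r"
    then have "\<forall>k\<in>F. (k, x) \<in> r" using m \<open>trans r\<close> by (meson transD)
    then show ?thesis using \<open>refl r\<close> by (auto simp: refl_onD)
  qed (use m in auto)
qed

lemma partial_order_on_UNIV_D:
  assumes "partial_order_on UNIV r"
  shows "refl r" "trans r" "antisym r"
  using assms by (simp_all add: partial_order_on_def preorder_on_def)

lemma under_converse: "under (r\<inverse>) = above r"
  by (simp add: fun_eq_iff under_def above_def)

text \<open>The lower cover of \<open>i\<close> is the greatest element of the chain strictly below
  \<open>i\<close>. By antisymmetry its down-set determines it, so a sum over
  \<open>{j. under r j = under r i - {i}}\<close> picks out just its term.\<close>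

lemma under_predecessor:
  fixes r :: "'n::finite rel"
  assumes po: "partial_order_on UNIV r" and tot: "total_on (under r i) r" and ne: "under r i \<noteq> {i}"
  obtains m where "(m, i) \<in> r" "m \<noteq> i" "under r m = under r i - {i}"
    "{j. under r j = under r i - {i}} = {m}"
proof -
  note refl = refl_onD[OF partial_order_on_UNIV_D(1)[OF po] UNIV_I]
    and trans = transD[OF partial_order_on_UNIV_D(2)[OF po]]
    and antisym = antisymD[OF partial_order_on_UNIV_D(3)[OF po]]
  let ?S = "under r i - {i}"
  have "i \<in> under r i" by (simp add: under_def refl)
  with ne have "?S \<noteq> {}" by blast
  moreover have "total_on ?S r" using tot by (auto simp: total_on_def)
  ultimately obtain m where m: "m \<in> ?S" "\<forall>k\<in>?S. (k, m) \<in> r"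
    using finite_total_on_greatest[of ?S r] partial_order_on_UNIV_D[OF po] by auto
  have mi: "(m, i) \<in> r" "m \<noteq> i" using m(1) by (auto simp: under_def)
  have eq: "under r m = ?S"
  proof (intro equalityI subsetI)
    fix k assume "k \<in> under r m"
    then have k: "(k, m) \<in> r" by (simp add: under_def)
    then have "k \<noteq> i" using mi antisym by blast
    then show "k \<in> ?S" using trans[OF k mi(1)] by (simp add: under_def)
  next
    fix k assume "k \<in> ?S"
    then show "k \<in> under r m" using m(2) by (simp add: under_def)
  qed
  have "j = m" if "under r j = under r m" for j
  proof -
    have "j \<in> under r m" "m \<in> under r j" using that by (auto simp: under_def refl)
    then show ?thesis using antisym by (simp add: under_def)
  qed
  then have "{j. under r j = under r m} = {m}" by blast
  then have "{j. under r j = ?S} = {m}" unfolding eq .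
  with mi eq show thesis by (rule that)
qed

text \<open>Along the chain \<open>b k\<close> is the value of \<open>g\<close> at the lower cover
  minus \<open>g k\<close>, with \<open>c\<close> at the minimal element, where reflexivity leaves
  the cover sum empty. The map uses \<open>c = 1\<close> and, for the converse order,
  \<open>c = 0\<close> with \<open>g\<close> negated.\<close>

lemma sum_under_telescope:
  fixes r :: "'n::finite rel" and b g :: "'n \<Rightarrow> real"
  assumes po: "partial_order_on UNIV r" and tot: "total_on (under r i) r"
    and b: "\<And>k. k \<in> under r i \<Longrightarrow>
      b k = c * of_bool (under r k = {k}) + (\<Sum>j | under r j = under r k - {k}. g j) - g k"
  shows "(\<Sum>k\<in>under r i. b k) = c - g i"
  using tot b
proof (induction "card (under r i)" arbitrary: i rule: less_induct)
  case less
  note refl = refl_onD[OF partial_order_on_UNIV_D(1)[OF po] UNIV_I]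
    and trans = transD[OF partial_order_on_UNIV_D(2)[OF po]]
  have i: "i \<in> under r i" by (simp add: under_def refl)
  show ?case
  proof (cases "under r i = {i}")
    case True
    have "{j. under r j = {}} = {}" using refl by (auto simp: under_def)
    then show ?thesis using less.prems(2)[OF i] True by simp
  next
    case False
    obtain m where m: "(m, i) \<in> r" "m \<noteq> i" "under r m = under r i - {i}"
      "{j. under r j = under r i - {i}} = {m}"
      using under_predecessor[OF po less.prems(1) False] by metis
    have sub: "under r m \<subset> under r i" using m(3) i by blast
    then have "card (under r m) < card (under r i)" by (simp add: psubset_card_mono)
    moreover have "total_on (under r m) r"
      using sub less.prems(1) unfolding total_on_def by blast
    moreover have "b k = c * of_bool (under r k = {k}) + (\<Sum>j | under r j = under r k - {k}. g j) - g k"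
      if "k \<in> under r m" for k
      using less.prems(2) sub that by blast
    ultimately have "(\<Sum>k\<in>under r m. b k) = c - g m" by (rule less.hyps)
    moreover have "b i = g m - g i" using less.prems(2)[OF i] m(4) False by simp
    moreover have "(\<Sum>k\<in>under r i. b k) = b i + (\<Sum>k\<in>under r m. b k)"
      unfolding m(3) using i by (simp add: sum.remove)
    ultimately show ?thesis by simp
  qed
qed

lemma det_in_Ints:
  fixes A :: "real ^ 'n ^ 'n::finite"
  assumes "\<And>i j. A $ i $ j \<in> \<int>"
  shows "det A \<in> \<int>"
  unfolding det_def using assms by (intro Ints_sum Ints_mult Ints_prod) auto

text \<open>Both determinants are integers, and their product is 1.\<close>

lemma det_unit_if_integer_inverse:
  fixes U V :: "real ^ 'n ^ 'n::finite"
  assumes "\<And>i j. U $ i $ j \<in> \<int>" "\<And>i j. V $ i $ j \<in> \<int>" "U ** V = mat 1"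
  shows "det U = 1 \<or> det U = - 1"
proof -
  obtain m n where mn: "det U = of_int m" "det V = of_int n"
    using assms(1,2) det_in_Ints by (metis Ints_cases)
  have "det U * det V = 1" using assms(3) by (metis det_I det_mul)
  then have "m * n = 1" unfolding mn by (metis of_int_eq_1_iff of_int_mult)
  then show ?thesis using zmult_eq_1_iff by (auto simp: mn)
qed

text \<open>Every \<open>i\<close> has a chain below it or a chain above it. On the down-set \<open>A\<close> of the former, put
  \<open>b\<^sub>i = a\<^sub>p - a\<^sub>i\<close>, where \<open>p\<close> is the unique lower cover of \<open>i\<close>, with \<open>1\<close> in place of \<open>a\<^sub>p\<close>
  for minimal \<open>i\<close>; off \<open>A\<close>, put \<open>b\<^sub>i = a\<^sub>i - a\<^sub>s\<close> for the unique upper cover \<open>s\<close>. Telescoping, the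
  inverse sends \<open>b\<close> to \<open>1 - \<Sum>\<^sub>j\<^sub>\<le>\<^sub>i b\<^sub>j\<close> on \<open>A\<close> and to \<open>\<Sum>\<^sub>j\<^sub>\<ge>\<^sub>i b\<^sub>j\<close> off \<open>A\<close>.\<close>

lemma total_on_imp_unimodularly_equivalent:
  fixes r :: "'n::finite rel"
  assumes po: "partial_order_on UNIV r"
    and tot: "\<And>i. total_on (under r i) r \<or> total_on (above r i) r"
  shows "unimodularly_equivalent (order_polytope r) (chain_polytope r)"
proof -
  note refl = refl_onD[OF partial_order_on_UNIV_D(1)[OF po] UNIV_I]
    and trans = transD[OF partial_order_on_UNIV_D(2)[OF po]]
    and antisym = antisymD[OF partial_order_on_UNIV_D(3)[OF po]]
  have po': "partial_order_on UNIV (r\<inverse>)" using po by simp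
  define A where "A = {i. total_on (under r i) r}"
  \<comment> \<open>Hence the chain below an element of \<open>A\<close> stays in \<open>A\<close>
    and the chain above an element outside stays outside: the two kinds of differences never mix
    within one telescoping sum.\<close>
  have A_down: "i \<in> A" if "(i, j) \<in> r" "j \<in> A" for i j
  proof -
    have "under r i \<subseteq> under r j" using that(1) trans by (auto simp: under_def)
    then show ?thesis using that(2) by (auto simp: A_def total_on_def)
  qed
  have totA: "total_on (under r i) r" if "i \<in> A" for i using that by (simp add: A_def)
  have tot_not_A: "total_on (above r i) r" if "i \<notin> A" for i using that tot by (auto simp: A_def)
  \<comment> \<open>Matrices act on row vectors, so column \<open>i\<close> holds the coefficients
    of \<open>b\<^sub>i\<close>. A cover is recognised by its down-set or up-set; where it is
    missing, \<open>w\<close> supplies 1 on \<open>A\<close>, and off \<open>A\<close> the value is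
    0.\<close>
  define U :: "real ^ 'n ^ 'n" where "U = (\<chi> j i. if i \<in> A
    then of_bool (under r j = under r i - {i}) - of_bool (j = i)
    else of_bool (j = i) - of_bool (above r j = above r i - {i}))"
  define w :: "real ^ 'n" where "w = (\<chi> i. of_bool (i \<in> A \<and> under r i = {i}))"
  define V :: "real ^ 'n ^ 'n" where
    "V = (\<chi> j i. if i \<in> A then - of_bool ((j, i) \<in> r) else of_bool ((i, j) \<in> r))"
  define w' :: "real ^ 'n" where "w' = (\<chi> i. of_bool (i \<in> A))"
  define \<phi> where "\<phi> a = a v* U + w" for a
  define \<psi> where "\<psi> b = b v* V + w'" for b
  have \<phi>_A: "\<phi> a $ i = of_bool (under r i = {i}) + (\<Sum>j | under r j = under r i - {i}. a $ j) - a $ i"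
    if "i \<in> A" for a i
    using that by (simp add: \<phi>_def U_def w_def vector_matrix_mult_def right_diff_distrib
        sum_subtractf sum_mult_of_bool_eq)
  have \<phi>_not_A: "\<phi> a $ i = a $ i - (\<Sum>j | above r j = above r i - {i}. a $ j)"
    if "i \<notin> A" for a i
    using that by (simp add: \<phi>_def U_def w_def vector_matrix_mult_def right_diff_distrib
        sum_subtractf sum_mult_of_bool_eq)
  have \<psi>_A: "\<psi> b $ i = 1 - (\<Sum>j\<in>under r i. b $ j)" if "i \<in> A" for b i
    using that by (simp add: \<psi>_def V_def w'_def vector_matrix_mult_def under_def
        sum_negf sum_mult_of_bool_eq)
  have \<psi>_not_A: "\<psi> b $ i = (\<Sum>j\<in>above r i. b $ j)" if "i \<notin> A" for b i
    using that by (simp add: \<psi>_def V_def w'_def vector_matrix_mult_def above_def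
        sum_mult_of_bool_eq)
  have \<psi>_\<phi>: "\<psi> (\<phi> a) = a" for a
    unfolding vec_eq_iff
  proof
    fix i
    show "\<psi> (\<phi> a) $ i = a $ i"
    proof (cases "i \<in> A")
      case True
      have "(\<Sum>k\<in>under r i. \<phi> a $ k) = 1 - a $ i"
      proof (rule sum_under_telescope[OF po totA[OF True]])
        fix k assume "k \<in> under r i"
        then have "k \<in> A" using A_down True by (auto simp: under_def)
        then show "\<phi> a $ k = 1 * of_bool (under r k = {k})
            + (\<Sum>j | under r j = under r k - {k}. a $ j) - a $ k"
          by (simp add: \<phi>_A)
      qed
      then show ?thesis using True by (simp add: \<psi>_A)
    next
      case False
      have "(\<Sum>k\<in>under (r\<inverse>) i. \<phi> a $ k) = 0 - (- a $ i)"
      proof (rule sum_under_telescope[OF po'])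
        show "total_on (under (r\<inverse>) i) (r\<inverse>)"
          using tot_not_A[OF False] by (simp add: under_converse)
        fix k assume "k \<in> under (r\<inverse>) i"
        then have "k \<notin> A" using A_down False by (auto simp: under_def)
        then show "\<phi> a $ k = 0 * of_bool (under (r\<inverse>) k = {k})
            + (\<Sum>j | under (r\<inverse>) j = under (r\<inverse>) k - {k}. - a $ j) - (- a $ k)"
          by (simp add: \<phi>_not_A under_converse sum_negf)
      qed
      then show ?thesis using False by (simp add: \<psi>_not_A under_converse)
    qed
  qed
  \<comment> \<open>Evaluating at 0 isolates the constants; what remains says that \<open>V\<close>
    inverts \<open>U\<close>.\<close>
  have "w v* V + w' = 0" using \<psi>_\<phi>[of 0] by (simp add: \<phi>_def \<psi>_def)
  then have "a v* U v* V = a" for a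
    using \<psi>_\<phi>[of a] by (simp add: \<phi>_def \<psi>_def vector_matrix_left_distrib add.assoc)
  then have "transpose (U ** V) *v a = mat 1 *v a" for a
    by (simp add: vector_matrix_mul_assoc)
  then have "transpose (U ** V) = mat 1" by (subst matrix_eq) blast
  then have UV: "U ** V = mat 1" by (metis transpose_mat transpose_transpose)
  then have VU: "V ** U = mat 1" by (simp add: matrix_left_right_inverse)
  have Uint: "U $ i $ j \<in> \<int>" for i j by (simp add: U_def)
  have Vint: "V $ i $ j \<in> \<int>" for i j by (simp add: V_def)
  have \<phi>_\<psi>: "\<phi> (\<psi> b) = b" for b
  proof -
    have "inj \<psi>"
    proof
      fix x y assume "\<psi> x = \<psi> y"
      then have "x v* V v* U = y v* V v* U" by (simp add: \<psi>_def)
      then show "x = y" by (simp add: vector_matrix_mul_assoc VU)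
    qed
    then show ?thesis using \<psi>_\<phi>[of "\<psi> b"] by (simp add: inj_eq)
  qed
  have \<phi>_in: "\<phi> a \<in> chain_polytope r" if a: "a \<in> order_polytope r" for a
  proof -
    have a01: "0 \<le> a $ i" "a $ i \<le> 1" for i using a by (auto simp: order_polytope_def)
    have a_anti: "a $ j \<le> a $ i" if "(i, j) \<in> r" for i j using a that by (auto simp: order_polytope_def)
    have nn: "0 \<le> \<phi> a $ i" for i
    proof (cases "i \<in> A")
      case True
      show ?thesis
      proof (cases "under r i = {i}")
        case True
        then show ?thesis using a01[of i] \<phi>_A[OF \<open>i \<in> A\<close>, of a] a01 by (simp add: sum_nonneg add_increasing2)
      next
        case False
        obtain m where "(m, i) \<in> r" "{j. under r j = under r i - {i}} = {m}"
          using under_predecessor[OF po totA[OF True] False] by metis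
        then show ?thesis using a_anti[of m i] \<phi>_A[OF True, of a] False by simp
      qed
    next
      case notA: False
      show ?thesis
      proof (cases "above r i = {i}")
        case True
        have "{j. above r j = {}} = {}" using refl by (auto simp: above_def)
        then show ?thesis using a01[of i] \<phi>_not_A[OF notA, of a] True by simp
      next
        case False
        obtain m where "(i, m) \<in> r" "{j. above r j = above r i - {i}} = {m}"
          using under_predecessor[OF po', of i] tot_not_A[OF notA] False
          unfolding under_converse total_on_converse by (metis converse_iff)
        then show ?thesis using a_anti[of i m] \<phi>_not_A[OF notA, of a] by simp
      qed
    qed
    \<comment> \<open>With \<open>m\<close> the top of \<open>C \<inter> A\<close> and
      \<open>l\<close> the bottom of \<open>C - A\<close>, telescoping bounds the two parts by
      \<open>1 - a $ m\<close> and \<open>a $ l\<close>. As \<open>A\<close> is a down-set,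
      \<open>m\<close> lies below \<open>l\<close>, so \<open>a $ l \<le> a $ m\<close>.\<close>
    have "(\<Sum>i\<in>C. \<phi> a $ i) \<le> 1" if C: "total_on C r" for C
    proof -
      have low: "(\<Sum>i\<in>C \<inter> A. \<phi> a $ i) \<le> 1 - a $ m" if "m \<in> A" "\<forall>k\<in>C \<inter> A. (k, m) \<in> r" for m
      proof -
        have "(\<Sum>i\<in>C \<inter> A. \<phi> a $ i) \<le> (\<Sum>i\<in>under r m. \<phi> a $ i)"
          using that nn by (intro sum_mono2) (auto simp: under_def)
        then show ?thesis using \<psi>_A[OF that(1), of "\<phi> a"] by (simp add: \<psi>_\<phi>)
      qed
      have up: "(\<Sum>i\<in>C - A. \<phi> a $ i) \<le> a $ l" if "l \<notin> A" "\<forall>k\<in>C - A. (l, k) \<in> r" for l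
      proof -
        have "(\<Sum>i\<in>C - A. \<phi> a $ i) \<le> (\<Sum>i\<in>above r l. \<phi> a $ i)"
          using that nn by (intro sum_mono2) (auto simp: above_def)
        then show ?thesis using \<psi>_not_A[OF that(1), of "\<phi> a"] by (simp add: \<psi>_\<phi>)
      qed
      have split: "(\<Sum>i\<in>C. \<phi> a $ i) = (\<Sum>i\<in>C \<inter> A. \<phi> a $ i) + (\<Sum>i\<in>C - A. \<phi> a $ i)"
        by (simp add: sum.Int_Diff[of C _ A])
      have max: "\<exists>m\<in>C \<inter> A. \<forall>k\<in>C \<inter> A. (k, m) \<in> r" if "C \<inter> A \<noteq> {}"
        using finite_total_on_greatest[of "C \<inter> A" r] that C partial_order_on_UNIV_D[OF po]
        by (auto simp: total_on_def)
      have min: "\<exists>l\<in>C - A. \<forall>k\<in>C - A. (l, k) \<in> r" if "C - A \<noteq> {}"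
        using finite_total_on_greatest[of "C - A" "r\<inverse>"] that C partial_order_on_UNIV_D[OF po']
        by (auto simp: total_on_def)
      consider "C \<inter> A = {}" "C - A = {}" | "C \<inter> A = {}" "C - A \<noteq> {}"
        | "C \<inter> A \<noteq> {}" "C - A = {}" | "C \<inter> A \<noteq> {}" "C - A \<noteq> {}" by blast
      then show ?thesis
      proof cases
        case 1
        then have "C = {}" by blast
        then show ?thesis by simp
      next
        case 2
        then obtain l where l: "l \<in> C - A" "\<forall>k\<in>C - A. (l, k) \<in> r" using min by blast
        then show ?thesis unfolding split 2(1) using up[of l] a01[of l] by simp
      next
        case 3
        then obtain m where m: "m \<in> C \<inter> A" "\<forall>k\<in>C \<inter> A. (k, m) \<in> r" using max by blast
        then show ?thesis unfolding split 3(2) using low[of m] a01[of m] by simp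
      next
        case 4
        obtain m where m: "m \<in> C \<inter> A" "\<forall>k\<in>C \<inter> A. (k, m) \<in> r" using max 4 by blast
        obtain l where l: "l \<in> C - A" "\<forall>k\<in>C - A. (l, k) \<in> r" using min 4 by blast
        have "(m, l) \<in> r \<or> (l, m) \<in> r"
          using C m(1) l(1) by (auto simp: total_on_def)
        moreover have "(l, m) \<notin> r" using A_down[of l m] m(1) l(1) by blast
        ultimately have "a $ l \<le> a $ m" using a_anti by blast
        moreover have "(\<Sum>i\<in>C \<inter> A. \<phi> a $ i) \<le> 1 - a $ m" using low m by blast
        moreover have "(\<Sum>i\<in>C - A. \<phi> a $ i) \<le> a $ l" using up l by blast
        ultimately show ?thesis unfolding split by linarith
      qed
    qed
    then show ?thesis using nn by (simp add: chain_polytope_alt)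
  qed
  have \<psi>_in: "\<psi> b \<in> order_polytope r" if "b \<in> chain_polytope r" for b
  proof -
    have nn: "0 \<le> b $ i" and le1: "total_on C r \<Longrightarrow> (\<Sum>i\<in>C. b $ i) \<le> 1" for i C
      using that by (auto simp: chain_polytope_alt)
    have "0 \<le> \<psi> b $ i \<and> \<psi> b $ i \<le> 1" for i
      by (cases "i \<in> A") (use nn in \<open>auto simp: \<psi>_A \<psi>_not_A sum_nonneg le1 totA tot_not_A\<close>)
    moreover have "\<psi> b $ j \<le> \<psi> b $ i" if ij: "(i, j) \<in> r" for i j
    proof -
      consider "i \<in> A" "j \<in> A" | "i \<in> A" "j \<notin> A" | "i \<notin> A" "j \<notin> A"
        using A_down[OF ij] by blast
      then show ?thesis
      proof cases
        case 1
        have "(\<Sum>k\<in>under r i. b $ k) \<le> (\<Sum>k\<in>under r j. b $ k)"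
          using nn ij trans by (intro sum_mono2) (auto simp: under_def)
        then show ?thesis using 1 by (simp add: \<psi>_A)
      next
        case 2
        \<comment> \<open>Since \<open>i\<close> lies below \<open>j\<close>, the two chains join to
          one, and its chain inequality is exactly the required
          \<open>\<psi> b $ j \<le> \<psi> b $ i\<close>.\<close>
        have "total_on (under r i \<union> above r j) r"
          using totA[OF 2(1)] tot_not_A[OF 2(2)] trans ij
          unfolding total_on_def under_def above_def by blast
        then have "(\<Sum>k\<in>under r i \<union> above r j. b $ k) \<le> 1" by (rule le1)
        moreover have "under r i \<inter> above r j = {}"
          using 2 A_down trans by (auto simp: under_def above_def)
        ultimately show ?thesis using 2 by (simp add: \<psi>_A \<psi>_not_A sum.union_disjoint)
      next
        case 3
        have "(\<Sum>k\<in>above r j. b $ k) \<le> (\<Sum>k\<in>above r i. b $ k)"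
          using nn ij trans by (intro sum_mono2) (auto simp: above_def)
        then show ?thesis using 3 by (simp add: \<psi>_not_A)
      qed
    qed
    ultimately show ?thesis by (auto simp: order_polytope_def)
  qed
  have "chain_polytope r = \<phi> ` order_polytope r"
    using \<phi>_in \<psi>_in \<phi>_\<psi> by (metis (no_types, lifting) image_eqI image_subsetI subsetI subset_antisym)
  moreover have "w $ i \<in> \<int>" for i by (simp add: w_def)
  ultimately show ?thesis
    unfolding unimodularly_equivalent_def \<phi>_def
    using Uint det_unit_if_integer_inverse[OF Uint Vint UV] by blast
qed

theorem theorem3p1:
  fixes r :: "'n::finite rel"
  assumes "partial_order_on UNIV r"
  shows "degree_sequence (skeleton1 (order_polytope r)) = degree_sequence (skeleton1 (chain_polytope r))
    \<longleftrightarrow> unimodularly_equivalent (order_polytope r) (chain_polytope r)"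
  using assms degree_sequence_eq_imp_total_on total_on_imp_unimodularly_equivalent
    unimodularly_equivalent_imp_degree_sequence_eq by blast

end
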